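(* Let $(\Omega,d)$ be a complete separable metric space and $\mu$ a Borel probability measure on $\Omega$. Let $\lambda_1>0$ and assume that $(\Omega,d,\mu)$ satisfies the following Poincar\'e inequality: for all locally Lipschitz functions $g:\Omega\to\mathbb{R}$, $$\int g\, d\mu = 0 \;\Rightarrow\; \lambda_1 \int g^2\, d\mu \leq \int |\nabla g|^2\, d\mu .$$ Let $L>0$. Then for any $L$-log-Lipschitz function $f$ on $\Omega$ and all $p,q$ with $$-\frac{2\sqrt{\lambda_1}}{L} < q < p < \frac{2\sqrt{\lambda_1}}{L},$$ one has $$\|f\|_{L^p(\mu)} \leq C_{L,q,p}\, \|f\|_{L^q(\mu)},$$ where $$C_{L,q,p} = \exp\left(L^2 \int_q^p K(|t|L)\, dt\right), \qquad K(\ell) := \frac{1}{2\lambda_1}\left(\frac{2\sqrt{\lambda_1}+\ell}{2\sqrt{\lambda_1}-\ell}\right)^2 \exp\left(\ell\sqrt{5/\lambda_1}\right).$$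
   Context: "Locally Lipschitz" means Lipschitz on every ball of $(\Omega,d)$. For such a function $g$, $|\nabla g|$ is the Borel function $|\nabla g|(x) := \limsup_{d(y,x)\to 0+} \frac{|g(y)-g(x)|}{d(x,y)}$, and $|\nabla g|(x):=0$ if $x$ is an isolated point. A positive function $f:\Omega\to(0,\infty)$ is called $L$-log-Lipschitz if $|\log f(x)-\log f(y)|\leq L\, d(x,y)$ for all $x,y\in\Omega$. For a positive Borel function $f$ and $p\in\mathbb{R}\setminus\{0\}$ (negative $p$ allowed), $\|f\|_{L^p(\mu)} := \left(\int f^p\, d\mu\right)^{1/p}$, and $\|f\|_{L^0(\mu)} := \exp\left(\int \log f\, d\mu\right)$. *)

theory Defs
  imports "HOL-Probability.Probability"
begin

definition lipschitz_on_balls :: "('a::metric_space \<Rightarrow> real) \<Rightarrow> bool" where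
  "lipschitz_on_balls g \<longleftrightarrow> (\<forall>x r. \<exists>C. C-lipschitz_on (ball x r) g)"

text \<open>The modulus of the gradient, with values in \<open>[0, \<infinity>]\<close>; it is finite for functions that are
  Lipschitz on balls. The filter \<open>at x\<close> is punctured, so the difference quotient has a nonzero
  denominator.\<close>

definition grad_mod :: "('a::metric_space \<Rightarrow> real) \<Rightarrow> 'a \<Rightarrow> ennreal" where
  "grad_mod g x =
     (if x islimpt UNIV then Limsup (at x) (\<lambda>y. ennreal (\<bar>g y - g x\<bar> / dist x y)) else 0)"

text \<open>The condition that \<open>g\<close> has mean zero includes integrability, since the Bochner integral of a
  non-integrable function is \<open>0\<close> by convention. The two quadratic integrals take
  values in \<open>[0, \<infinity>]\<close>.\<close>

definition poincare_inequality :: "real \<Rightarrow> 'a::metric_space measure \<Rightarrow> bool" where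
  "poincare_inequality lam M \<longleftrightarrow>
     (\<forall>g. lipschitz_on_balls g \<longrightarrow> integrable M g \<longrightarrow> (\<integral>x. g x \<partial>M) = 0 \<longrightarrow>
        ennreal lam * (\<integral>\<^sup>+x. ennreal ((g x)\<^sup>2) \<partial>M) \<le> (\<integral>\<^sup>+x. (grad_mod g x)\<^sup>2 \<partial>M))"

definition log_lipschitz :: "real \<Rightarrow> ('a::metric_space \<Rightarrow> real) \<Rightarrow> bool" where
  "log_lipschitz L f \<longleftrightarrow> (\<forall>x. 0 < f x) \<and> (\<forall>x y. \<bar>ln (f x) - ln (f y)\<bar> \<le> L * dist x y)"

text \<open>Real powers on \<open>[0, \<infinity>]\<close>, meant for nonzero exponents:
  \<open>0\<close> and \<open>\<infinity>\<close> are exchanged when the exponent is negative.\<close>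

definition ennreal_powr :: "ennreal \<Rightarrow> real \<Rightarrow> ennreal" where
  "ennreal_powr x a =
     (if x = 0 then (if a < 0 then \<infinity> else 0)
      else if x = \<infinity> then (if a < 0 then 0 else \<infinity>)
      else ennreal (enn2real x powr a))"

definition ereal_exp :: "ereal \<Rightarrow> ennreal" where
  "ereal_exp x =
     (if x = \<infinity> then \<infinity> else if x = -\<infinity> then 0 else ennreal (exp (real_of_ereal x)))"

text \<open>The integral in the extended sense, as the integral of the positive part minus that of the
  negative part (\<open>ennreal\<close> maps negative reals to \<open>0\<close>). It is meaningful unless both parts have
  infinite integral.\<close>

definition extended_integral :: "'a measure \<Rightarrow> ('a \<Rightarrow> real) \<Rightarrow> ereal" where
  "extended_integral M h =
     enn2ereal (\<integral>\<^sup>+x. ennreal (h x) \<partial>M) - enn2ereal (\<integral>\<^sup>+x. ennreal (- h x) \<partial>M)"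

definition Lp_norm :: "'a measure \<Rightarrow> real \<Rightarrow> ('a \<Rightarrow> real) \<Rightarrow> ennreal" where
  "Lp_norm M p f =
     (if p = 0 then ereal_exp (extended_integral M (\<lambda>x. ln (f x)))
      else ennreal_powr (\<integral>\<^sup>+x. ennreal (f x powr p) \<partial>M) (1 / p))"

definition K_fun :: "real \<Rightarrow> real \<Rightarrow> real" where
  "K_fun lam l =
     1 / (2 * lam) * ((2 * sqrt lam + l) / (2 * sqrt lam - l))\<^sup>2 * exp (l * sqrt (5 / lam))"

definition C_const :: "real \<Rightarrow> real \<Rightarrow> real \<Rightarrow> real \<Rightarrow> real" where
  "C_const lam L q p = exp (L\<^sup>2 * integral {q..p} (\<lambda>t. K_fun lam (\<bar>t\<bar> * L)))"

end

theory Submission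
  imports Defs
begin

text \<open>
  Write \<open>h = ln f\<close> and \<open>N(t) = ln \<parallel>f\<parallel>\<^sub>t\<close>, with \<open>N(0) = \<integral> h d\<mu>\<close>. Then \<open>t\<^sup>2 N'(t)\<close> is the entropy of
  \<open>e\<^bsup>th\<^esup>\<close> divided by its mean, so the theorem reduces to the modified logarithmic Sobolev inequality
  \<open>Ent(e\<^sup>u) \<le> K(c) c\<^sup>2 \<integral> e\<^sup>u d\<mu>\<close> of Bobkov and Ledoux for a bounded \<open>c\<close>-Lipschitz \<open>u\<close> with \<open>c < 2 \<surd>\<lambda>\<^sub>1\<close>.
  For centred \<open>u\<close>, the elementary bound \<open>x e\<^sup>x - e\<^sup>x + 1 \<le> x\<^sup>2 (1/6 + e\<^sup>x/3)\<close> leaves \<open>\<integral> u\<^sup>2 d\<mu>\<close> and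
  \<open>\<integral> u\<^sup>2 e\<^sup>u d\<mu>\<close> to estimate. The latter is controlled by the Poincare inequality for \<open>u e\<^bsup>u/2\<^esup>\<close>, the former by
  the latter through the Poincare inequality for \<open>u\<^sup>2\<close>. Unbounded \<open>h\<close> are truncated; the
  uniform variance bound on the truncations makes \<open>h\<close> integrable, and the inequality for bounded
  functions with \<open>q = 0\<close> makes \<open>e\<^bsup>th\<^esup>\<close> integrable.
\<close>


section \<open>Cauchy-Schwarz and the Poincare inequality for functions of a Lipschitz
  function\<close>

text \<open>The integral of \<open>(s * f x - t * g x)^2\<close> is a nonnegative quadratic form in
  \<open>s\<close> and \<open>t\<close>; two choices of the arguments give the claim.\<close>

lemma Cauchy_Schwarz_lebesgue_integral:
  fixes f g :: "'a \<Rightarrow> real"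
  assumes "integrable M (\<lambda>x. (f x)\<^sup>2)" "integrable M (\<lambda>x. (g x)\<^sup>2)" "integrable M (\<lambda>x. f x * g x)"
  shows "(\<integral>x. f x * g x \<partial>M)\<^sup>2 \<le> (\<integral>x. (f x)\<^sup>2 \<partial>M) * (\<integral>x. (g x)\<^sup>2 \<partial>M)"
proof -
  define A B C where "A = (\<integral>x. (f x)\<^sup>2 \<partial>M)" and "B = (\<integral>x. f x * g x \<partial>M)" and "C = (\<integral>x. (g x)\<^sup>2 \<partial>M)"
  have quad: "0 \<le> s\<^sup>2 * A - 2 * s * t * B + t\<^sup>2 * C" for s t
  proof -
    have "0 \<le> (\<integral>x. (s * f x - t * g x)\<^sup>2 \<partial>M)"
      by (intro integral_nonneg_AE) auto
    also have "\<dots> = (\<integral>x. s\<^sup>2 * (f x)\<^sup>2 - (2 * s * t) * (f x * g x) + t\<^sup>2 * (g x)\<^sup>2 \<partial>M)"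
      by (intro Bochner_Integration.integral_cong) (auto simp: power2_eq_square algebra_simps)
    also have "\<dots> = s\<^sup>2 * A - 2 * s * t * B + t\<^sup>2 * C"
      using assms by (simp add: A_def B_def C_def)
    finally show ?thesis .
  qed
  have "C \<ge> 0"
    unfolding C_def by (intro integral_nonneg_AE) auto
  have "B\<^sup>2 \<le> A * C"
  proof (cases "C = 0")
    case True
    have "B = 0"
    proof (rule ccontr)
      assume "B \<noteq> 0"
      \<comment> \<open>With \<open>C = 0\<close> the form is affine in \<open>t\<close>; the chosen
        \<open>t\<close> makes it equal to \<open>A - (A + 1) = -1\<close>.\<close>
      then show False
        using quad[of 1 "(A + 1) / (2 * B)"] quad[of 1 0] True by (simp add: field_simps)
    qed
    then show ?thesis using True by simp
  next
    case False
    with \<open>C \<ge> 0\<close> have "C > 0" by simp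
    \<comment> \<open>At \<open>s = C\<close>, \<open>t = B\<close> the form equals
      \<open>C * (A * C - B^2)\<close>.\<close>
    have "0 \<le> C * (A * C - B\<^sup>2)"
      using quad[of C B] by (simp add: power2_eq_square algebra_simps)
    then show ?thesis using \<open>C > 0\<close> by (simp add: zero_le_mult_iff)
  qed
  then show ?thesis by (simp add: A_def B_def C_def)
qed

text \<open>One half of a chain rule: near \<open>x\<close> the increment of
  \<open>\<phi> (u y)\<close> is \<open>D\<close> times that of \<open>u\<close>, up to a small
  multiple of it, and the increment of \<open>u\<close> is at most \<open>c * dist x y\<close>. At
  isolated points the left side is 0.\<close>

lemma grad_mod_comp_le:
  assumes u: "c-lipschitz_on UNIV u" and phi: "(\<phi> has_real_derivative D) (at (u x))"
  shows "grad_mod (\<lambda>x. \<phi> (u x)) x \<le> ennreal (c * \<bar>D\<bar>)"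
proof (cases "x islimpt UNIV")
  case False
  then show ?thesis by (simp add: grad_mod_def)
next
  case True
  have c: "c \<ge> 0" using u by (rule lipschitz_on_nonneg)
  have "Limsup (at x) (\<lambda>y. ennreal (\<bar>\<phi> (u y) - \<phi> (u x)\<bar> / dist x y)) \<le> ennreal (c * \<bar>D\<bar>)"
  proof (rule ennreal_le_epsilon)
    fix e :: real assume e: "0 < e"
    \<comment> \<open>The linearisation error has to stay below \<open>e * dist x y\<close> after
      multiplication by \<open>c\<close>; the summand 1 covers \<open>c = 0\<close>.\<close>
    define e' where "e' = e / (c + 1)"
    have e': "e' > 0" "c * e' \<le> e" using e c by (auto simp: e'_def field_simps)
    obtain d where d: "d > 0"
      "\<And>y. norm (y - u x) < d \<Longrightarrow> norm (\<phi> y - \<phi> (u x) - D * (y - u x)) \<le> e' * norm (y - u x)"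
      using phi e'(1) unfolding has_field_derivative_def has_derivative_at_alt by blast
    have "isCont u x"
      using lipschitz_on_continuous_on[OF u] by (simp add: continuous_on_eq_continuous_at)
    then have "\<forall>\<^sub>F y in at x. dist (u y) (u x) < d"
      using d(1) by (auto simp: isCont_def tendsto_iff)
    moreover have "\<forall>\<^sub>F y in at x. y \<noteq> x"
      by (simp add: eventually_at_filter)
    ultimately have "\<forall>\<^sub>F y in at x. ennreal (\<bar>\<phi> (u y) - \<phi> (u x)\<bar> / dist x y) \<le> ennreal (c * \<bar>D\<bar> + e)"
    proof eventually_elim
      case (elim y)
      have lip: "\<bar>u y - u x\<bar> \<le> c * dist x y"
        using lipschitz_onD[OF u, of y x] by (simp add: dist_real_def dist_commute)
      have "\<bar>\<phi> (u y) - \<phi> (u x)\<bar> \<le> \<bar>\<phi> (u y) - \<phi> (u x) - D * (u y - u x)\<bar> + \<bar>D\<bar> * \<bar>u y - u x\<bar>"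
        using abs_triangle_ineq[of "\<phi> (u y) - \<phi> (u x) - D * (u y - u x)" "D * (u y - u x)"]
        by (simp add: abs_mult)
      also have "\<dots> \<le> e' * \<bar>u y - u x\<bar> + \<bar>D\<bar> * \<bar>u y - u x\<bar>"
        using d(2)[of "u y"] elim(1) by (simp add: dist_real_def)
      also have "\<dots> \<le> (e' + \<bar>D\<bar>) * (c * dist x y)"
        using mult_left_mono[OF lip, of "e' + \<bar>D\<bar>"] e' by (simp add: algebra_simps)
      also have "\<dots> \<le> (c * \<bar>D\<bar> + e) * dist x y"
        using mult_right_mono[OF e'(2), of "dist x y"] by (simp add: algebra_simps)
      finally show ?case
        using elim(2) by (intro ennreal_leI) (simp add: divide_le_eq)
    qed
    then have "Limsup (at x) (\<lambda>y. ennreal (\<bar>\<phi> (u y) - \<phi> (u x)\<bar> / dist x y))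
        \<le> ennreal (c * \<bar>D\<bar> + e)"
      by (rule Limsup_bounded)
    then show "Limsup (at x) (\<lambda>y. ennreal (\<bar>\<phi> (u y) - \<phi> (u x)\<bar> / dist x y))
        \<le> ennreal (c * \<bar>D\<bar>) + ennreal e"
      using c e by (subst ennreal_plus[symmetric]) auto
  qed
  with True show ?thesis by (simp add: grad_mod_def)
qed

text \<open>\<open>u\<close> maps a ball into a compact interval, on which the continuous derivative
  of \<open>\<phi>\<close> is bounded. This makes functions such as \<open>u * exp (u / 2)\<close>
  admissible in the Poincare inequality, although \<open>\<phi>\<close> is not globally
  Lipschitz.\<close>

lemma lipschitz_on_balls_comp:
  assumes u: "c-lipschitz_on UNIV u"
    and phi: "\<And>s. (\<phi> has_real_derivative \<phi>' s) (at s)" "continuous_on UNIV \<phi>'"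
  shows "lipschitz_on_balls (\<lambda>x. \<phi> (u x))"
  unfolding lipschitz_on_balls_def
proof (intro allI)
  fix x :: 'a and r :: real
  define I where "I = cball (u x) (c * r)"
  have c: "c \<ge> 0" using u by (rule lipschitz_on_nonneg)
  have "compact (\<phi>' ` I)"
    unfolding I_def by (intro compact_continuous_image continuous_on_subset[OF phi(2)]) auto
  then have "bounded (\<phi>' ` I)" by (rule compact_imp_bounded)
  then obtain B where B: "\<And>z. z \<in> I \<Longrightarrow> norm (\<phi>' z) \<le> B"
    unfolding bounded_iff by auto
  \<comment> \<open>The absolute value matters when \<open>I\<close> is empty (\<open>c * r\<close>
    negative), since nothing then forces \<open>B\<close> to be nonnegative.\<close>
  have "\<bar>B\<bar>-lipschitz_on I \<phi>"
  proof (rule lipschitz_onI)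
    fix y z assume yz: "y \<in> I" "z \<in> I"
    have "norm (\<phi> y - \<phi> z) \<le> B * norm (y - z)"
      by (rule field_differentiable_bound[OF _ has_field_derivative_at_within[OF phi(1)] B yz])
         (simp_all add: I_def)
    also have "\<dots> \<le> \<bar>B\<bar> * norm (y - z)" by (intro mult_right_mono) auto
    finally show "dist (\<phi> y) (\<phi> z) \<le> \<bar>B\<bar> * dist y z" by (simp add: dist_norm)
  qed auto
  moreover have "u ` ball x r \<subseteq> I"
  proof safe
    fix y assume "y \<in> ball x r"
    then have "c * dist x y \<le> c * r" using c by (intro mult_left_mono) auto
    then show "u y \<in> I"
      using lipschitz_onD[OF u, of x y] by (simp add: I_def)
  qed
  ultimately have "(\<bar>B\<bar> * c)-lipschitz_on (ball x r) (\<phi> \<circ> u)"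
    by (rule lipschitz_on_compose[OF lipschitz_on_subset[OF u subset_UNIV] lipschitz_on_subset])
  then show "\<exists>C. C-lipschitz_on (ball x r) (\<lambda>x. \<phi> (u x))"
    by (auto simp: o_def)
qed

locale poincare_space = prob_space M for M :: "'a::metric_space measure" +
  fixes lam :: real
  assumes sets_eq [measurable_cong]: "sets M = sets borel"
    and lam_pos: "lam > 0"
    and poincare: "poincare_inequality lam M"
begin

lemma lipschitz_measurable:
  assumes "c-lipschitz_on UNIV (u :: 'a \<Rightarrow> real)"
  shows "u \<in> borel_measurable M"
  using borel_measurable_continuous_onI[OF lipschitz_on_continuous_on[OF assms]]
    measurable_cong_sets[OF sets_eq refl] by blast

text \<open>A continuous function is bounded on the compact closure of the range of
  \<open>u\<close>, and the measure is finite. This settles integrability for all integrands built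
  from a bounded function.\<close>

lemma integrable_comp:
  assumes "u \<in> borel_measurable M" "bounded (range u)" "continuous_on UNIV (\<psi> :: real \<Rightarrow> real)"
  shows "integrable M (\<lambda>x. \<psi> (u x))"
proof -
  have compact: "compact (closure (range u))" using assms(2) by simp
  have "compact (\<psi> ` closure (range u))"
    by (rule compact_continuous_image[OF continuous_on_subset[OF assms(3) subset_UNIV] compact])
  then have "bounded (\<psi> ` closure (range u))" by (rule compact_imp_bounded)
  then obtain B where B: "\<And>z. z \<in> closure (range u) \<Longrightarrow> norm (\<psi> z) \<le> B"
    unfolding bounded_iff by auto
  have "norm (\<psi> (u x)) \<le> B" for x
    using closure_subset[of "range u"] by (intro B) auto
  moreover have "(\<lambda>x. \<psi> (u x)) \<in> borel_measurable M"
    by (rule measurable_compose[OF assms(1) borel_measurable_continuous_onI[OF assms(3)]])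
  ultimately show ?thesis
    by (intro integrable_const_bound[where B = B]) auto
qed

text \<open>The variance form of the Poincare hypothesis, obtained by subtracting the mean from
  \<open>\<phi> (u x)\<close> and bounding the gradient by the chain rule. All later spectral gap
  arguments go through this form.\<close>

lemma poincare_comp:
  assumes u: "c-lipschitz_on UNIV u" "bounded (range u)"
    and phi: "\<And>s. (\<phi> has_real_derivative \<phi>' s) (at s)" "continuous_on UNIV \<phi>'"
  shows "lam * ((\<integral>x. (\<phi> (u x))\<^sup>2 \<partial>M) - (\<integral>x. \<phi> (u x) \<partial>M)\<^sup>2) \<le> c\<^sup>2 * (\<integral>x. (\<phi>' (u x))\<^sup>2 \<partial>M)"
proof -
  define m where "m = (\<integral>x. \<phi> (u x) \<partial>M)"
  note [measurable] = lipschitz_measurable[OF u(1)]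
  have cphi: "continuous_on UNIV \<phi>"
    using phi(1) by (meson DERIV_isCont continuous_at_imp_continuous_on)
  note int = integrable_comp[OF lipschitz_measurable[OF u(1)] u(2)]
  have i1: "integrable M (\<lambda>x. \<phi> (u x))" by (intro int cphi)
  have i2: "integrable M (\<lambda>x. (\<phi> (u x))\<^sup>2)"
    by (intro int[where \<psi> = "\<lambda>s. (\<phi> s)\<^sup>2"] continuous_intros cphi)
  have i3: "integrable M (\<lambda>x. (\<phi>' (u x))\<^sup>2)"
    by (intro int[where \<psi> = "\<lambda>s. (\<phi>' s)\<^sup>2"] continuous_intros phi)
  have i4: "integrable M (\<lambda>x. (\<phi> (u x) - m)\<^sup>2)"
    by (intro int[where \<psi> = "\<lambda>s. (\<phi> s - m)\<^sup>2"] continuous_intros cphi)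
  have c: "c \<ge> 0" using u(1) by (rule lipschitz_on_nonneg)
  have d: "((\<lambda>s. \<phi> s - m) has_real_derivative \<phi>' s) (at s)" for s
    using phi(1)[of s] by (auto intro!: derivative_eq_intros)
  have "lipschitz_on_balls (\<lambda>x. \<phi> (u x) - m)"
    by (rule lipschitz_on_balls_comp[OF u(1) d phi(2)])
  moreover have "integrable M (\<lambda>x. \<phi> (u x) - m)" using i1 by simp
  moreover have "(\<integral>x. \<phi> (u x) - m \<partial>M) = 0" using i1 by (simp add: m_def prob_space)
  ultimately have "ennreal lam * (\<integral>\<^sup>+x. ennreal ((\<phi> (u x) - m)\<^sup>2) \<partial>M)
      \<le> (\<integral>\<^sup>+x. (grad_mod (\<lambda>x. \<phi> (u x) - m) x)\<^sup>2 \<partial>M)"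
    using poincare unfolding poincare_inequality_def by blast
  also have "\<dots> \<le> (\<integral>\<^sup>+x. ennreal (c\<^sup>2 * (\<phi>' (u x))\<^sup>2) \<partial>M)"
  proof (intro nn_integral_mono)
    fix x
    have "(grad_mod (\<lambda>x. \<phi> (u x) - m) x)\<^sup>2 \<le> (ennreal (c * \<bar>\<phi>' (u x)\<bar>))\<^sup>2"
      by (intro power_mono grad_mod_comp_le[OF u(1) d]) auto
    also have "\<dots> = ennreal (c\<^sup>2 * (\<phi>' (u x))\<^sup>2)"
      using c by (simp add: ennreal_power power_mult_distrib)
    finally show "(grad_mod (\<lambda>x. \<phi> (u x) - m) x)\<^sup>2 \<le> ennreal (c\<^sup>2 * (\<phi>' (u x))\<^sup>2)" .
  qed
  also have "\<dots> = ennreal (\<integral>x. c\<^sup>2 * (\<phi>' (u x))\<^sup>2 \<partial>M)"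
    using i3 by (intro nn_integral_eq_integral) auto
  also have "(\<integral>\<^sup>+x. ennreal ((\<phi> (u x) - m)\<^sup>2) \<partial>M) = ennreal (\<integral>x. (\<phi> (u x) - m)\<^sup>2 \<partial>M)"
    using i4 by (intro nn_integral_eq_integral) auto
  finally have "lam * (\<integral>x. (\<phi> (u x) - m)\<^sup>2 \<partial>M) \<le> c\<^sup>2 * (\<integral>x. (\<phi>' (u x))\<^sup>2 \<partial>M)"
    using lam_pos by (simp flip: ennreal_mult)
  also have "(\<integral>x. (\<phi> (u x) - m)\<^sup>2 \<partial>M) = (\<integral>x. (\<phi> (u x))\<^sup>2 - 2 * m * \<phi> (u x) + m\<^sup>2 \<partial>M)"
    by (intro Bochner_Integration.integral_cong) (auto simp: power2_eq_square algebra_simps)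
  also have "\<dots> = (\<integral>x. (\<phi> (u x))\<^sup>2 \<partial>M) - 2 * m * m + m\<^sup>2"
    using i1 i2 by (simp add: prob_space m_def)
  finally show ?thesis by (simp add: m_def power2_eq_square)
qed

end


section \<open>The modified logarithmic Sobolev inequality for bounded functions\<close>

text \<open>The difference \<open>g\<close> of the two sides vanishes at 0, and its derivative is
  \<open>x / 3\<close> times a nonnegative factor, so 0 is a global minimum. The two sides agree to
  third order at 0.\<close>

lemma exp_entropy_le:
  fixes x :: real
  shows "x * exp x - exp x + 1 \<le> x\<^sup>2 * (1 / 6 + exp x / 3)"
proof -
  define g where "g x = x\<^sup>2 * (1 / 6 + exp x / 3) - (x * exp x - exp x + 1)" for x :: real
  define g' where "g' x = x / 3 * (1 + exp x * (x - 1))" for x :: real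
  have g: "(g has_real_derivative g' x) (at x)" for x
    unfolding g_def g'_def
    by (auto intro!: derivative_eq_intros simp: power2_eq_square field_simps)
  have pos: "0 \<le> 1 + exp x * (x - 1)" for x :: real
  proof -
    have "exp x * (1 - x) \<le> exp x * exp (- x)"
      using exp_ge_add_one_self[of "- x"] by (intro mult_left_mono) auto
    then show ?thesis by (simp add: algebra_simps flip: exp_add)
  qed
  have "g 0 \<le> g x"
  proof (cases "x \<ge> 0")
    case True
    show ?thesis
      using g pos by (intro DERIV_nonneg_imp_nondecreasing[OF True]) (auto simp: g'_def intro!: exI)
  next
    case False
    show ?thesis
    proof (rule DERIV_nonpos_imp_nonincreasing[of x 0 g])
      fix y :: real assume "x \<le> y" "y \<le> 0"
      then have "g' y \<le> 0" using pos[of y] by (simp add: g'_def mult_le_0_iff)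
      then show "\<exists>z. (g has_real_derivative z) (at y) \<and> z \<le> 0" using g by blast
    qed (use False in auto)
  qed
  then show ?thesis by (simp add: g_def)
qed

context poincare_space
begin

text \<open>The Poincare inequality for \<open>u * exp (u / 2)\<close> bounds \<open>A - D^2\<close>
  by \<open>F\<close>, \<open>G\<close> and \<open>A / 4\<close>. Once \<open>G\<close> and
  \<open>D\<close> are estimated by \<open>A\<close> and \<open>F\<close>, the result is a linear
  inequality between \<open>sqrt A\<close> and \<open>sqrt F\<close>, which can be solved for
  \<open>sqrt A\<close> because \<open>c < 2 * sqrt lam\<close>.\<close>

lemma weighted_second_moment_le:
  assumes u: "c-lipschitz_on UNIV u" "bounded (range u)" and mean: "(\<integral>x. u x \<partial>M) = 0"
    and c: "c < 2 * sqrt lam"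
  shows "(\<integral>x. (u x)\<^sup>2 * exp (u x) \<partial>M) \<le>
    c\<^sup>2 / lam * ((2 * sqrt lam + c) / (2 * sqrt lam - c))\<^sup>2 * (\<integral>x. exp (u x) \<partial>M)"
proof -
  note int = integrable_comp[OF lipschitz_measurable[OF u(1)] u(2)]
  have c0: "c \<ge> 0" using u(1) by (rule lipschitz_on_nonneg)
  define A F G D m where "A = (\<integral>x. (u x)\<^sup>2 * exp (u x) \<partial>M)" and "F = (\<integral>x. exp (u x) \<partial>M)"
    and "G = (\<integral>x. u x * exp (u x) \<partial>M)" and "D = (\<integral>x. u x * exp (u x / 2) \<partial>M)"
    and "m = (\<integral>x. exp (u x / 2) \<partial>M)"
  have half: "exp (s / 2) * exp (s / 2) = exp s" "(exp (s / 2))\<^sup>2 = exp s" for s :: real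
    by (simp_all add: power2_eq_square flip: exp_add)
  have iA: "integrable M (\<lambda>x. (u x)\<^sup>2 * exp (u x))" by (intro int continuous_intros)
  have iF: "integrable M (\<lambda>x. exp (u x))" by (intro int continuous_intros)
  have iG: "integrable M (\<lambda>x. u x * exp (u x))" by (intro int continuous_intros)
  have iD: "integrable M (\<lambda>x. u x * exp (u x / 2))" by (intro int continuous_intros) auto
  have im: "integrable M (\<lambda>x. exp (u x / 2))" by (intro int continuous_intros) auto
  have iu: "integrable M u" using int[of "\<lambda>s. s"] by simp
  have iu2: "integrable M (\<lambda>x. (u x)\<^sup>2)" by (intro int continuous_intros)
  have "A \<ge> 0" "F \<ge> 0" unfolding A_def F_def by (intro integral_nonneg_AE; simp)+
  have G: "G\<^sup>2 \<le> A * F"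
    using Cauchy_Schwarz_lebesgue_integral[of M "\<lambda>x. u x * exp (u x / 2)" "\<lambda>x. exp (u x / 2)"] iA iF iG
    by (simp add: power_mult_distrib half mult.assoc A_def F_def G_def)
  have V: "lam * (\<integral>x. (u x)\<^sup>2 \<partial>M) \<le> c\<^sup>2"
    using poincare_comp[OF u, of "\<lambda>s. s" "\<lambda>_. 1"] mean by (simp add: prob_space)
  have W: "lam * (F - m\<^sup>2) \<le> c\<^sup>2 * (F / 4)"
  proof -
    have cont: "continuous_on UNIV (\<lambda>s::real. exp (s / 2) / 2)" by (intro continuous_intros) auto
    have "((\<lambda>s. exp (s / 2)) has_real_derivative exp (s / 2) / 2) (at s)" for s :: real
      by (auto intro!: derivative_eq_intros)
    from poincare_comp[where \<phi> = "\<lambda>s. exp (s / 2)" and \<phi>' = "\<lambda>s. exp (s / 2) / 2", OF u this cont]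
    have "lam * ((\<integral>x. (exp (u x / 2))\<^sup>2 \<partial>M) - m\<^sup>2) \<le> c\<^sup>2 * (\<integral>x. (exp (u x / 2) / 2)\<^sup>2 \<partial>M)"
      unfolding m_def .
    then show ?thesis by (simp add: half power_divide F_def)
  qed
  \<comment> \<open>\<open>u\<close> is centred, so \<open>D\<close> is the covariance of \<open>u\<close> and \<open>exp (u / 2)\<close>.\<close>
  have D: "D\<^sup>2 \<le> (\<integral>x. (u x)\<^sup>2 \<partial>M) * (F - m\<^sup>2)"
  proof -
    have eq: "(exp (s / 2) - m)\<^sup>2 = exp s - 2 * m * exp (s / 2) + m\<^sup>2" for s
      by (simp add: power2_diff half)
    have "(\<integral>x. u x * (exp (u x / 2) - m) \<partial>M) = D - m * (\<integral>x. u x \<partial>M)"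
      using iD iu by (simp add: D_def algebra_simps)
    moreover have "(\<integral>x. (exp (u x / 2) - m)\<^sup>2 \<partial>M) = F - m\<^sup>2"
      using iF im by (simp add: eq F_def prob_space flip: m_def) (simp add: power2_eq_square)
    moreover have "integrable M (\<lambda>x. (exp (u x / 2) - m)\<^sup>2)"
      unfolding eq using iF im by simp
    moreover have "integrable M (\<lambda>x. u x * (exp (u x / 2) - m))"
      using iD iu by (simp add: algebra_simps)
    ultimately show ?thesis
      using Cauchy_Schwarz_lebesgue_integral[OF iu2, of "\<lambda>x. exp (u x / 2) - m"] mean by simp
  qed
  have P: "lam * (A - D\<^sup>2) \<le> c\<^sup>2 * (F + G + A / 4)"
  proof -
    have cont: "continuous_on UNIV (\<lambda>s::real. (1 + s / 2) * exp (s / 2))" by (intro continuous_intros) auto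
    have "((\<lambda>s. s * exp (s / 2)) has_real_derivative (1 + s / 2) * exp (s / 2)) (at s)" for s :: real
      by (auto intro!: derivative_eq_intros simp: algebra_simps)
    from poincare_comp[where \<phi> = "\<lambda>s. s * exp (s / 2)" and \<phi>' = "\<lambda>s. (1 + s / 2) * exp (s / 2)", OF u this cont]
    have "lam * ((\<integral>x. (u x * exp (u x / 2))\<^sup>2 \<partial>M) - D\<^sup>2)
        \<le> c\<^sup>2 * (\<integral>x. ((1 + u x / 2) * exp (u x / 2))\<^sup>2 \<partial>M)"
      unfolding D_def .
    also have "(\<integral>x. ((1 + u x / 2) * exp (u x / 2))\<^sup>2 \<partial>M)
        = (\<integral>x. exp (u x) + u x * exp (u x) + (u x)\<^sup>2 * exp (u x) / 4 \<partial>M)"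
      by (intro Bochner_Integration.integral_cong refl)
         (simp add: power_mult_distrib half, simp add: power2_eq_square algebra_simps)
    also have "\<dots> = F + G + A / 4"
      using iF iG iA by (simp add: F_def G_def A_def)
    finally show ?thesis by (simp add: A_def power_mult_distrib half)
  qed
  \<comment> \<open>Square roots turn the quadratic inequality \<open>P\<close> into one that
    becomes linear in \<open>x\<close> and \<open>y\<close>.\<close>
  define s x y where "s = sqrt lam" and "x = sqrt A" and "y = sqrt F"
  have s: "s > 0" "lam = s\<^sup>2" and x: "x \<ge> 0" "A = x\<^sup>2" and y: "y \<ge> 0" "F = y\<^sup>2"
    using lam_pos \<open>A \<ge> 0\<close> \<open>F \<ge> 0\<close> by (simp_all add: s_def x_def y_def)
  have G': "G \<le> x * y"
    using G x y by (auto intro: power2_le_imp_le[of G] simp: power_mult_distrib)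
  \<comment> \<open>Both variances in \<open>D\<close> are bounded by the Poincare inequality: that
    of \<open>u\<close> by \<open>c^2 / lam\<close>, that of \<open>exp (u / 2)\<close> by
    \<open>c^2 * F / (4 * lam)\<close>.\<close>
  have D': "(s * D)\<^sup>2 \<le> (c\<^sup>2 * y / (2 * s))\<^sup>2"
  proof -
    have "s\<^sup>2 * (s * D)\<^sup>2 \<le> (lam * (\<integral>x. (u x)\<^sup>2 \<partial>M)) * (lam * (F - m\<^sup>2))"
      using mult_left_mono[OF D, of "lam * lam"] lam_pos s
      by (simp add: power_mult_distrib algebra_simps)
    also have "\<dots> \<le> c\<^sup>2 * (c\<^sup>2 * (F / 4))"
    proof (rule mult_mono[OF V W])
      have "0 \<le> (\<integral>x. (exp (u x / 2) - m)\<^sup>2 \<partial>M)"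
        by (intro integral_nonneg_AE) auto
      also have "\<dots> = F - m\<^sup>2"
        using iF im by (simp add: power2_diff half F_def prob_space flip: m_def)
          (simp add: power2_eq_square)
      finally show "0 \<le> lam * (F - m\<^sup>2)" using lam_pos by simp
    qed simp
    finally show ?thesis
      using s y by (simp add: power_divide power_mult_distrib field_simps)
  qed
  have "(s * x)\<^sup>2 \<le> (s * D)\<^sup>2 + c\<^sup>2 * (F + G + A / 4)"
    using P by (simp add: s x power_mult_distrib algebra_simps)
  also have "\<dots> \<le> (c\<^sup>2 * y / (2 * s))\<^sup>2 + c\<^sup>2 * (F + x * y + A / 4)"
    using D' G' by (intro add_mono mult_left_mono) auto
  \<comment> \<open>Replacing \<open>G\<close> by its bound \<open>x * y\<close> has completed the
    square.\<close>
  also have "c\<^sup>2 * (F + x * y + A / 4) = (c * (y + x / 2))\<^sup>2"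
    by (simp add: x y power2_eq_square field_simps)
  \<comment> \<open>The sum of squares is at most the square of the sum for nonnegative terms; a
    square root can then be taken on both sides.\<close>
  also have "(c\<^sup>2 * y / (2 * s))\<^sup>2 + (c * (y + x / 2))\<^sup>2 \<le> (c\<^sup>2 * y / (2 * s) + c * (y + x / 2))\<^sup>2"
    using s x y c0 by (simp add: power2_sum)
  finally have "s * x \<le> c\<^sup>2 * y / (2 * s) + c * (y + x / 2)"
    by (rule power2_le_imp_le) (use s x y c0 in auto)
  then have "x * (2 * s - c) \<le> c / s * (2 * s + c) * y"
    using s by (simp add: field_simps power2_eq_square)
  then have "x \<le> c / s * (2 * s + c) * y / (2 * s - c)"
    using c by (subst pos_le_divide_eq) (auto simp: s_def)
  then have "x \<le> c / s * ((2 * s + c) / (2 * s - c)) * y"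
    by (simp add: mult_ac)
  then have "x\<^sup>2 \<le> (c / s * ((2 * s + c) / (2 * s - c)) * y)\<^sup>2"
    using x by (intro power_mono)
  then show ?thesis
    unfolding A_def[symmetric] F_def[symmetric] s_def[symmetric]
    by (simp add: x y s(2) power_mult_distrib power_divide)
qed

text \<open>Jensen's inequality for the weight \<open>u^2\<close> would give
  \<open>V * exp (T / V)\<close> as a lower bound for the weighted moment, so a bound
  \<open>T \<ge> - k * V\<close> on the third moment suffices. It follows from a fourth moment
  bound, which is the source of \<open>sqrt (5 / lam)\<close>.\<close>

lemma second_moment_le_weighted:
  assumes u: "c-lipschitz_on UNIV u" "bounded (range u)" and mean: "(\<integral>x. u x \<partial>M) = 0"
  shows "(\<integral>x. (u x)\<^sup>2 \<partial>M) \<le> exp (c * sqrt (5 / lam)) * (\<integral>x. (u x)\<^sup>2 * exp (u x) \<partial>M)"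
proof -
  note int = integrable_comp[OF lipschitz_measurable[OF u(1)] u(2)]
  define k where "k = c * sqrt (5 / lam)"
  have c0: "c \<ge> 0" using u(1) by (rule lipschitz_on_nonneg)
  then have k0: "k \<ge> 0" using lam_pos by (simp add: k_def)
  have k2: "k\<^sup>2 = 5 * c\<^sup>2 / lam" using lam_pos by (simp add: k_def power_mult_distrib)
  define V T Q where "V = (\<integral>x. (u x)\<^sup>2 \<partial>M)" and "T = (\<integral>x. (u x)^3 \<partial>M)" and "Q = (\<integral>x. (u x)^4 \<partial>M)"
  have i2: "integrable M (\<lambda>x. (u x)\<^sup>2)" by (intro int continuous_intros)
  have i3: "integrable M (\<lambda>x. (u x)^3)" by (intro int continuous_intros)
  have i4: "integrable M (\<lambda>x. (u x)^4)" by (intro int continuous_intros)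
  have iA: "integrable M (\<lambda>x. (u x)\<^sup>2 * exp (u x))" by (intro int continuous_intros)
  have V0: "V \<ge> 0" unfolding V_def by (intro integral_nonneg_AE) auto
  have V: "lam * V \<le> c\<^sup>2"
    using poincare_comp[OF u, of "\<lambda>s. s" "\<lambda>_. 1"] mean by (simp add: prob_space V_def)
  \<comment> \<open>The Poincare inequality for \<open>u^2\<close> contributes 4 to the factor 5,
    and the squared mean \<open>V^2\<close>, bounded through \<open>V\<close>, contributes
    1.\<close>
  have Q: "lam * Q \<le> 5 * c\<^sup>2 * V"
  proof -
    have cont: "continuous_on UNIV (\<lambda>s::real. 2 * s)" by (intro continuous_intros)
    have "((\<lambda>s. s\<^sup>2) has_real_derivative 2 * s) (at s)" for s :: real
      by (auto intro!: derivative_eq_intros)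
    from poincare_comp[where \<phi> = "\<lambda>s. s\<^sup>2" and \<phi>' = "\<lambda>s. 2 * s", OF u this cont]
    have "lam * ((\<integral>x. ((u x)\<^sup>2)\<^sup>2 \<partial>M) - V\<^sup>2) \<le> c\<^sup>2 * (\<integral>x. (2 * u x)\<^sup>2 \<partial>M)"
      unfolding V_def .
    then have "lam * (Q - V\<^sup>2) \<le> 4 * c\<^sup>2 * V"
      by (simp add: Q_def V_def power_mult_distrib)
    moreover have "lam * V\<^sup>2 \<le> c\<^sup>2 * V"
      using mult_right_mono[OF V V0] by (simp add: power2_eq_square algebra_simps)
    ultimately show ?thesis by (simp add: algebra_simps)
  qed
  \<comment> \<open>This is Cauchy-Schwarz for \<open>T\<close> against \<open>V\<close> and
    \<open>Q \<le> k^2 * V\<close>, carried out by integrating \<open>u^2 * (k + u)^2\<close>. For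
    \<open>k = 0\<close> nothing could be divided out; there \<open>V\<close> and \<open>Q\<close>
    vanish, and integrating \<open>u^2 * (1 + u)^2\<close> gives the sign of
    \<open>T\<close>.\<close>
  have T: "0 \<le> T + k * V"
  proof (cases "k = 0")
    case True
    then have "c = 0" using lam_pos by (simp add: k_def)
    then have "Q \<le> 0" using Q lam_pos by (simp add: mult_le_0_iff)
    moreover have "0 \<le> (\<integral>x. (u x)\<^sup>2 + 2 * (u x)^3 + (u x)^4 \<partial>M)"
    proof (intro integral_nonneg_AE AE_I2)
      fix x
      have "(u x)\<^sup>2 + 2 * (u x)^3 + (u x)^4 = (u x)\<^sup>2 * (1 + u x)\<^sup>2"
        by (simp add: power2_eq_square power3_eq_cube power4_eq_xxxx algebra_simps)
      then show "0 \<le> (u x)\<^sup>2 + 2 * (u x)^3 + (u x)^4" by simp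
    qed
    ultimately have "0 \<le> V + 2 * T"
      using i2 i3 i4 by (simp add: V_def T_def Q_def)
    moreover have "V \<le> 0" using V \<open>c = 0\<close> lam_pos by (simp add: mult_le_0_iff)
    ultimately show ?thesis using True by simp
  next
    case False
    have "0 \<le> (\<integral>x. k\<^sup>2 * (u x)\<^sup>2 + 2 * k * (u x)^3 + (u x)^4 \<partial>M)"
    proof (intro integral_nonneg_AE AE_I2)
      fix x
      have "k\<^sup>2 * (u x)\<^sup>2 + 2 * k * (u x)^3 + (u x)^4 = (u x)\<^sup>2 * (k + u x)\<^sup>2"
        by (simp add: power2_eq_square power3_eq_cube power4_eq_xxxx algebra_simps)
      then show "0 \<le> k\<^sup>2 * (u x)\<^sup>2 + 2 * k * (u x)^3 + (u x)^4" by simp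
    qed
    also have "\<dots> = k\<^sup>2 * V + 2 * k * T + Q"
      using i2 i3 i4 by (simp add: V_def T_def Q_def)
    finally have "0 \<le> k\<^sup>2 * V + 2 * k * T + Q" .
    moreover have "Q \<le> k\<^sup>2 * V"
      using Q lam_pos by (simp add: k2 field_simps)
    ultimately have "0 \<le> 2 * k * (T + k * V)"
      by (simp add: power2_eq_square algebra_simps)
    then show ?thesis using False k0 by (simp add: zero_le_mult_iff)
  qed
  \<comment> \<open>Jensen's inequality for the weight \<open>u\<^sup>2\<close>, via the tangent line of \<open>exp\<close> at \<open>- k\<close>.\<close>
  have "exp (- k) * V \<le> exp (- k) * (V + (T + k * V))"
    using T by (intro mult_left_mono) auto
  also have "\<dots> = (\<integral>x. exp (- k) * ((u x)\<^sup>2 * (1 + k) + (u x)^3) \<partial>M)"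
    using i2 i3 by (simp add: V_def T_def algebra_simps)
  also have "\<dots> \<le> (\<integral>x. (u x)\<^sup>2 * exp (u x) \<partial>M)"
  proof (intro integral_mono)
    fix x
    have "exp (- k) * ((u x)\<^sup>2 * (1 + k) + (u x)^3) = (u x)\<^sup>2 * (exp (- k) * (1 + (k + u x)))"
      by (simp add: power2_eq_square power3_eq_cube algebra_simps)
    also have "\<dots> \<le> (u x)\<^sup>2 * (exp (- k) * exp (k + u x))"
      by (intro mult_left_mono exp_ge_add_one_self) auto
    finally show "exp (- k) * ((u x)\<^sup>2 * (1 + k) + (u x)^3) \<le> (u x)\<^sup>2 * exp (u x)"
      by (simp flip: exp_add)
  qed (use i2 i3 iA in auto)
  finally show ?thesis
    by (simp add: V_def k_def exp_minus field_simps)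
qed

text \<open>After linearisation the elementary exponential inequality leaves two second moments; the
  unweighted one is traded for the weighted one, and that for \<open>F\<close>.\<close>

lemma entropy_exp_le_centered:
  assumes u: "c-lipschitz_on UNIV u" "bounded (range u)" and mean: "(\<integral>x. u x \<partial>M) = 0"
    and c: "c < 2 * sqrt lam"
  defines "F \<equiv> (\<integral>x. exp (u x) \<partial>M)"
  shows "(\<integral>x. u x * exp (u x) \<partial>M) - F * ln F \<le> K_fun lam c * c\<^sup>2 * F"
proof -
  note int = integrable_comp[OF lipschitz_measurable[OF u(1)] u(2)]
  define A V E where "A = (\<integral>x. (u x)\<^sup>2 * exp (u x) \<partial>M)" and "V = (\<integral>x. (u x)\<^sup>2 \<partial>M)"
    and "E = exp (c * sqrt (5 / lam))"
  have iA: "integrable M (\<lambda>x. (u x)\<^sup>2 * exp (u x))" by (intro int continuous_intros)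
  have iF: "integrable M (\<lambda>x. exp (u x))" by (intro int continuous_intros)
  have iG: "integrable M (\<lambda>x. u x * exp (u x))" by (intro int continuous_intros)
  have iu: "integrable M u" using int[of "\<lambda>s. s"] by simp
  have iu2: "integrable M (\<lambda>x. (u x)\<^sup>2)" by (intro int continuous_intros)
  have c0: "c \<ge> 0" using u(1) by (rule lipschitz_on_nonneg)
  have "1 = (\<integral>x. 1 + u x \<partial>M)" using iu mean by (simp add: prob_space)
  also have "\<dots> \<le> F" unfolding F_def
    using iF iu by (intro integral_mono) auto
  finally have F: "F \<ge> 1" .
  have A0: "A \<ge> 0" unfolding A_def by (intro integral_nonneg_AE) auto
  have E1: "E \<ge> 1" using c0 lam_pos by (simp add: E_def)
  \<comment> \<open>\<open>F ln F \<ge> F - 1\<close> linearises the entropy.\<close>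
  have "F * ln (inverse F) \<le> F * (inverse F - 1)"
    using F by (intro mult_left_mono ln_le_minus_one) auto
  then have "F - 1 \<le> F * ln F" using F by (simp add: ln_inverse algebra_simps)
  then have "(\<integral>x. u x * exp (u x) \<partial>M) - F * ln F \<le> (\<integral>x. u x * exp (u x) \<partial>M) - F + 1" by simp
  also have "\<dots> = (\<integral>x. u x * exp (u x) - exp (u x) + 1 \<partial>M)"
    using iG iF by (simp add: F_def prob_space)
  also have "\<dots> \<le> (\<integral>x. (u x)\<^sup>2 / 6 + (u x)\<^sup>2 * exp (u x) / 3 \<partial>M)"
    using iG iF iu2 iA exp_entropy_le by (intro integral_mono) (auto simp: algebra_simps)
  also have "\<dots> = V / 6 + A / 3"
    using iu2 iA by (simp add: V_def A_def)
  \<comment> \<open>\<open>V \<le> E * A\<close> is used in the first term and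
    \<open>1 \<le> E\<close> in the second; the weights 1/6 and 1/3 add up to the factor 1/2 of
    \<open>K_fun\<close>.\<close>
  also have "\<dots> \<le> E * A / 2"
    using second_moment_le_weighted[OF u mean] mult_right_mono[OF E1 A0]
    by (simp add: V_def A_def E_def)
  also have "\<dots> \<le> E * (c\<^sup>2 / lam * ((2 * sqrt lam + c) / (2 * sqrt lam - c))\<^sup>2 * F) / 2"
    using weighted_second_moment_le[OF u mean c] E1
    by (intro divide_right_mono mult_left_mono) (auto simp: A_def F_def)
  finally show ?thesis
    by (simp add: K_fun_def E_def mult_ac)
qed

text \<open>Entropy is homogeneous of degree one: subtracting the mean \<open>a\<close> from
  \<open>u\<close> multiplies both sides by \<open>exp (- a)\<close>, so the centred case is
  enough.\<close>

lemma entropy_exp_le: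
  assumes u: "c-lipschitz_on UNIV u" "bounded (range u)" and c: "c < 2 * sqrt lam"
  defines "F \<equiv> (\<integral>x. exp (u x) \<partial>M)"
  shows "(\<integral>x. u x * exp (u x) \<partial>M) - F * ln F \<le> K_fun lam c * c\<^sup>2 * F"
proof -
  note int = integrable_comp[OF lipschitz_measurable[OF u(1)] u(2)]
  have iF: "integrable M (\<lambda>x. exp (u x))" by (intro int continuous_intros)
  have iG: "integrable M (\<lambda>x. u x * exp (u x))" by (intro int continuous_intros)
  have iu: "integrable M u" using int[of "\<lambda>s. s"] by simp
  define a where "a = (\<integral>x. u x \<partial>M)"
  define v where "v x = u x - a" for x
  have "F > 0"
    unfolding F_def using iF by (intro expectation_greater) auto
  have v: "c-lipschitz_on UNIV v"
    using lipschitz_on_diff[OF u(1) lipschitz_on_constant[of UNIV a]] by (simp add: v_def[abs_def])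
  have bv: "bounded (range v)"
    using bounded_translation[OF u(2), of "- a"] by (simp add: v_def image_image)
  have mean: "(\<integral>x. v x \<partial>M) = 0" using iu by (simp add: v_def a_def prob_space)
  have Fv: "(\<integral>x. exp (v x) \<partial>M) = exp (- a) * F"
    by (simp add: v_def F_def exp_diff exp_minus field_simps)
  have Gv: "(\<integral>x. v x * exp (v x) \<partial>M) = exp (- a) * ((\<integral>x. u x * exp (u x) \<partial>M) - a * F)"
  proof -
    have "(\<integral>x. v x * exp (v x) \<partial>M) = (\<integral>x. exp (- a) * (u x * exp (u x) - a * exp (u x)) \<partial>M)"
      by (simp add: v_def exp_diff exp_minus field_simps)
    then show ?thesis using iF iG by (simp add: F_def)
  qed
  have "exp (- a) * ((\<integral>x. u x * exp (u x) \<partial>M) - a * F) - exp (- a) * F * ln (exp (- a) * F)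
      \<le> K_fun lam c * c\<^sup>2 * (exp (- a) * F)"
    using entropy_exp_le_centered[OF v bv mean c] unfolding Fv Gv .
  then have "exp (- a) * ((\<integral>x. u x * exp (u x) \<partial>M) - F * ln F) \<le> exp (- a) * (K_fun lam c * c\<^sup>2 * F)"
    using \<open>F > 0\<close> by (simp add: ln_mult algebra_simps)
  then show ?thesis by simp
qed

end


section \<open>Auxiliary bounds and truncation\<close>

text \<open>The separate value at 0 is the continuous extension for bounded measurable
  \<open>h\<close>; total division would give 0 there.\<close>

definition log_norm :: "'a measure \<Rightarrow> ('a \<Rightarrow> real) \<Rightarrow> real \<Rightarrow> real" where
  "log_norm M h t = (if t = 0 then \<integral>x. h x \<partial>M else ln (\<integral>x. exp (t * h x) \<partial>M) / t)"

lemma K_fun_continuous_on: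
  assumes "L > 0" "- (2 * sqrt lam / L) < a" "b < 2 * sqrt lam / L"
  shows "continuous_on {a..b} (\<lambda>t. K_fun lam (\<bar>t\<bar> * L))"
proof -
  have "2 * sqrt lam - \<bar>t\<bar> * L \<noteq> 0" if "t \<in> {a..b}" for t
  proof -
    have "\<bar>t\<bar> < 2 * sqrt lam / L" using that assms by auto
    then show ?thesis using assms(1) by (simp add: field_simps)
  qed
  then show ?thesis
    unfolding K_fun_def by (intro continuous_intros) auto
qed

lemma exp_remainder_bounds:
  fixes b :: real
  shows "0 \<le> exp b - 1 - b" "exp b - 1 - b \<le> b\<^sup>2 * exp \<bar>b\<bar>"
proof -
  show "0 \<le> exp b - 1 - b" using exp_ge_add_one_self[of b] by linarith
  have upper: "exp y - 1 \<le> y * exp y" for y :: real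
    using mult_left_mono[OF exp_ge_add_one_self[of "- y"], of "exp y"]
    by (simp add: algebra_simps flip: exp_add)
  have "b * (exp b - 1) \<le> \<bar>b\<bar> * (\<bar>b\<bar> * exp \<bar>b\<bar>)"
  proof (cases "b \<ge> 0")
    case True
    then show ?thesis using upper[of b] by (simp add: mult_left_mono)
  next
    case False
    have "1 - exp b \<le> - b" using exp_ge_add_one_self[of b] by linarith
    also have "\<dots> \<le> - b * exp (- b)"
      using False by (simp add: mult_le_cancel_left1)
    finally have "- b * (1 - exp b) \<le> - b * (- b * exp (- b))"
      using False by (intro mult_left_mono) auto
    then show ?thesis using False by (simp add: algebra_simps)
  qed
  then show "exp b - 1 - b \<le> b\<^sup>2 * exp \<bar>b\<bar>"
    using upper[of b] by (simp add: power2_eq_square algebra_simps flip: abs_mult)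
qed

text \<open>A first-order expansion in the exponent whose error constant does not depend on
  \<open>y\<close> in \<open>[-B, B]\<close>, so that it can be integrated. The restriction on
  \<open>s - t\<close> keeps \<open>\<bar>b\<bar>\<close> below \<open>B\<close>.\<close>

lemma abs_exp_increment_remainder_le:
  fixes y :: real
  assumes "\<bar>y\<bar> \<le> B" "\<bar>s - t\<bar> \<le> 1"
  shows "\<bar>exp (s * y) - exp (t * y) - (s - t) * (y * exp (t * y))\<bar> \<le> B\<^sup>2 * exp (B + \<bar>t\<bar> * B) * (s - t)\<^sup>2"
proof -
  define b where "b = (s - t) * y"
  have B: "B \<ge> 0" using assms(1) by linarith
  have "exp (s * y) = exp (t * y) * exp b"
    by (simp add: b_def algebra_simps flip: exp_add)
  then have eq: "exp (s * y) - exp (t * y) - (s - t) * (y * exp (t * y)) = exp (t * y) * (exp b - 1 - b)"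
    by (simp add: b_def algebra_simps)
  have "\<bar>b\<bar> \<le> B"
    using mult_mono[OF assms(2,1)] by (simp add: b_def abs_mult)
  moreover have "b\<^sup>2 \<le> B\<^sup>2 * (s - t)\<^sup>2"
    using power_mono[OF assms(1) abs_ge_zero, of 2]
    by (simp add: b_def power_mult_distrib mult.commute[of "(s - t)\<^sup>2"] mult_right_mono)
  ultimately have "b\<^sup>2 * exp \<bar>b\<bar> \<le> B\<^sup>2 * (s - t)\<^sup>2 * exp B"
    by (intro mult_mono) auto
  then have "exp b - 1 - b \<le> B\<^sup>2 * (s - t)\<^sup>2 * exp B"
    using exp_remainder_bounds(2)[of b] by linarith
  moreover have "t * y \<le> \<bar>t\<bar> * B"
    using mult_left_mono[OF assms(1), of "\<bar>t\<bar>"] by (simp add: abs_mult[symmetric])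
  ultimately have "exp (t * y) * (exp b - 1 - b) \<le> exp (\<bar>t\<bar> * B) * (B\<^sup>2 * (s - t)\<^sup>2 * exp B)"
    using exp_remainder_bounds(1)[of b] by (intro mult_mono) auto
  then show ?thesis
    using exp_remainder_bounds(1)[of b] unfolding eq
    by (simp add: exp_add mult_ac)
qed

text \<open>Fatou's lemma; it transfers uniform bounds for truncations to the untruncated
  function.\<close>

lemma integrable_of_bounded_approx:
  fixes f :: "'a \<Rightarrow> real"
  assumes "\<And>n. integrable M (g n)" "\<And>n x. 0 \<le> g n x" "\<And>n. (\<integral>x. g n x \<partial>M) \<le> B"
    and [measurable]: "f \<in> borel_measurable M" and lim: "\<And>x. (\<lambda>n. g n x) \<longlonglongrightarrow> f x"
  shows "integrable M f"
proof (rule integrableI_bounded)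
  note [measurable] = borel_measurable_integrable[OF assms(1)]
  have pos: "0 \<le> f x" for x
    by (rule LIMSEQ_le_const[OF lim]) (use assms(2) in auto)
  have "(\<integral>\<^sup>+x. ennreal (norm (f x)) \<partial>M) = (\<integral>\<^sup>+x. liminf (\<lambda>n. ennreal (g n x)) \<partial>M)"
  proof (rule nn_integral_cong)
    fix x
    have "(\<lambda>n. ennreal (g n x)) \<longlonglongrightarrow> ennreal (f x)" using lim by simp
    from lim_imp_Liminf[OF _ this] show "ennreal (norm (f x)) = liminf (\<lambda>n. ennreal (g n x))"
      using pos by simp
  qed
  also have "\<dots> \<le> liminf (\<lambda>n. \<integral>\<^sup>+x. ennreal (g n x) \<partial>M)"
    by (rule nn_integral_liminf) measurable
  also have "\<dots> \<le> ennreal B"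
  proof (rule Liminf_le)
    show "\<forall>\<^sub>F n in sequentially. (\<integral>\<^sup>+x. ennreal (g n x) \<partial>M) \<le> ennreal B"
      using assms(1-3) by (simp add: nn_integral_eq_integral ennreal_leI)
  qed simp
  also have "\<dots> < \<infinity>" by simp
  finally show "(\<integral>\<^sup>+x. ennreal (norm (f x)) \<partial>M) < \<infinity>" .
qed measurable

definition clamp_at :: "nat \<Rightarrow> ('a \<Rightarrow> real) \<Rightarrow> 'a \<Rightarrow> real" where
  "clamp_at n h x = max (- real n) (min (real n) (h x))"

text \<open>Clamping is 1-Lipschitz, so truncation keeps \<open>L\<close> and with it the range of
  exponents and the constant.\<close>

lemma clamp_at_lipschitz:
  assumes "L-lipschitz_on UNIV h"
  shows "L-lipschitz_on UNIV (clamp_at n h)"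
proof (rule lipschitz_onI)
  fix x y
  have "dist (clamp_at n h x) (clamp_at n h y) \<le> dist (h x) (h y)"
    by (auto simp: clamp_at_def dist_real_def max_def min_def)
  also have "\<dots> \<le> L * dist x y"
    using assms by (rule lipschitz_onD) auto
  finally show "dist (clamp_at n h x) (clamp_at n h y) \<le> L * dist x y" .
qed (rule lipschitz_on_nonneg[OF assms])

lemma bounded_clamp_at: "bounded (range (clamp_at n h))"
  unfolding bounded_iff by (rule exI[of _ "real n"]) (auto simp: clamp_at_def max_def min_def)

lemma abs_clamp_at_le: "\<bar>clamp_at n h x\<bar> \<le> \<bar>h x\<bar>"
  by (auto simp: clamp_at_def max_def min_def)

lemma clamp_at_tendsto: "(\<lambda>n. clamp_at n h x) \<longlonglongrightarrow> h x"
proof (rule tendsto_eventually)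
  obtain N where "\<bar>h x\<bar> \<le> real N" using real_arch_simple by blast
  then show "\<forall>\<^sub>F n in sequentially. clamp_at n h x = h x"
    by (intro eventually_sequentiallyI[of N]) (auto simp: clamp_at_def max_def min_def)
qed

lemma (in prob_space) integral_exp_pos:
  "integrable M (\<lambda>x. exp (h x :: real)) \<Longrightarrow> 0 < (\<integral>x. exp (h x) \<partial>M)"
  by (intro expectation_greater) auto

section \<open>Growth of the norm in the exponent for bounded functions\<close>

context poincare_space
begin

text \<open>Differentiation under the integral: the pointwise remainder is quadratic in
  \<open>s - t\<close> uniformly in \<open>x\<close>, hence so is its integral.\<close>

lemma mgf_has_derivative:
  assumes h: "h \<in> borel_measurable M" "bounded (range h)"
  shows "((\<lambda>t. \<integral>x. exp (t * h x) \<partial>M) has_real_derivative (\<integral>x. h x * exp (t * h x) \<partial>M)) (at t)"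
proof -
  note int = integrable_comp[OF h]
  have iF: "integrable M (\<lambda>x. exp (s * h x))" for s by (intro int continuous_intros)
  have iG: "integrable M (\<lambda>x. h x * exp (s * h x))" for s by (intro int continuous_intros)
  obtain B where B: "\<And>x. \<bar>h x\<bar> \<le> B" using h(2) by (auto simp: bounded_iff)
  define C where "C = B\<^sup>2 * exp (B + \<bar>t\<bar> * B)"
  have C: "C \<ge> 0" by (simp add: C_def)
  define F where "F s = (\<integral>x. exp (s * h x) \<partial>M)" for s
  define G where "G = (\<integral>x. h x * exp (t * h x) \<partial>M)"
  have rem: "\<bar>F s - F t - G * (s - t)\<bar> \<le> C * (s - t)\<^sup>2" if "\<bar>s - t\<bar> \<le> 1" for s
  proof -
    have eq: "F s - F t - G * (s - t) = (\<integral>x. exp (s * h x) - exp (t * h x) - (s - t) * (h x * exp (t * h x)) \<partial>M)"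
      using iF iG by (simp add: F_def G_def)
    have "\<bar>F s - F t - G * (s - t)\<bar> \<le> (\<integral>x. \<bar>exp (s * h x) - exp (t * h x) - (s - t) * (h x * exp (t * h x))\<bar> \<partial>M)"
      unfolding eq by (rule integral_abs_bound)
    also have "\<dots> \<le> C * (s - t)\<^sup>2"
    proof (rule integral_le_const)
      show "integrable M (\<lambda>x. \<bar>exp (s * h x) - exp (t * h x) - (s - t) * (h x * exp (t * h x))\<bar>)"
        by (intro integrable_abs Bochner_Integration.integrable_diff integrable_mult_right iF iG)
    qed (unfold C_def, intro AE_I2 abs_exp_increment_remainder_le[OF B that])
    finally show ?thesis .
  qed
  have "(F has_derivative (\<lambda>y. G * y)) (at t)"
    unfolding has_derivative_at_alt
  proof (intro conjI allI impI)
    show "bounded_linear (\<lambda>y. G * y)" by (rule bounded_linear_mult_right)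
    fix e :: real assume e: "e > 0"
    define d where "d = min 1 (e / (C + 1))"
    have "norm (F s - F t - G * (s - t)) \<le> e * norm (s - t)" if "norm (s - t) < d" for s
    proof -
      have s: "\<bar>s - t\<bar> \<le> 1" "\<bar>s - t\<bar> \<le> e / (C + 1)" using that by (auto simp: d_def)
      have "C * \<bar>s - t\<bar> \<le> (C + 1) * \<bar>s - t\<bar>" by (simp add: algebra_simps)
      also have "\<dots> \<le> e" using s(2) C by (simp add: field_simps)
      finally have "C * \<bar>s - t\<bar> * \<bar>s - t\<bar> \<le> e * \<bar>s - t\<bar>" by (rule mult_right_mono) simp
      then show ?thesis
        using rem[OF s(1)] by (simp add: power2_eq_square mult.assoc)
    qed
    moreover have "d > 0" using e C by (simp add: d_def)
    ultimately show "\<exists>d>0. \<forall>s. norm (s - t) < d \<longrightarrow> norm (F s - F t - G * (s - t)) \<le> e * norm (s - t)"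
      by blast
  qed
  then show ?thesis by (simp add: has_field_derivative_def F_def[abs_def] G_def)
qed

lemma ln_mgf_has_derivative:
  assumes h: "h \<in> borel_measurable M" "bounded (range h)"
  shows "((\<lambda>t. ln (\<integral>x. exp (t * h x) \<partial>M)) has_real_derivative
    (\<integral>x. h x * exp (t * h x) \<partial>M) / (\<integral>x. exp (t * h x) \<partial>M)) (at t)"
proof -
  have "0 < (\<integral>x. exp (t * h x) \<partial>M)"
    by (intro integral_exp_pos integrable_comp[OF h] continuous_intros)
  then show ?thesis
    using mgf_has_derivative[OF h, of t] by (auto intro!: derivative_eq_intros)
qed

text \<open>The quotient rule. The numerator is the entropy of \<open>exp (t * h)\<close> divided by
  its mean \<open>F\<close>, which is what the logarithmic Sobolev inequality bounds.\<close>

lemma log_norm_has_derivative: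
  assumes h: "h \<in> borel_measurable M" "bounded (range h)" and t: "t \<noteq> 0"
  defines "F \<equiv> (\<integral>x. exp (t * h x) \<partial>M)"
  shows "(log_norm M h has_real_derivative
    (t * (\<integral>x. h x * exp (t * h x) \<partial>M) / F - ln F) / t\<^sup>2) (at t)"
proof -
  have "((\<lambda>t. ln (\<integral>x. exp (t * h x) \<partial>M) / t) has_real_derivative
      (t * (\<integral>x. h x * exp (t * h x) \<partial>M) / F - ln F) / t\<^sup>2) (at t)"
    unfolding F_def using t
    by (rule DERIV_cong[OF DERIV_divide[OF ln_mgf_has_derivative[OF h] DERIV_ident]])
      (auto simp: power2_eq_square mult_ac)
  then show ?thesis
    by (rule has_field_derivative_transform_within_open[where S = "- {0}"])
      (use t in \<open>auto simp: log_norm_def\<close>)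
qed

lemma isCont_log_norm:
  assumes h: "h \<in> borel_measurable M" "bounded (range h)"
  shows "isCont (log_norm M h) t"
proof (cases "t = 0")
  case False
  then show ?thesis using log_norm_has_derivative[OF h] DERIV_isCont by blast
next
  case True
  \<comment> \<open>The quotient is the difference quotient at 0 of the logarithm of the moment
    generating function, whose value at 0 is \<open>ln 1 = 0\<close>.\<close>
  have "(\<lambda>t. ln (\<integral>x. exp (t * h x) \<partial>M) / t) \<midarrow>0\<rightarrow> (\<integral>x. h x \<partial>M)"
    using ln_mgf_has_derivative[OF h, of 0] by (simp add: DERIV_def prob_space)
  then have "log_norm M h \<midarrow>0\<rightarrow> (\<integral>x. h x \<partial>M)"
    by (rule Lim_transform_eventually) (auto simp: log_norm_def eventually_at_filter)
  then show ?thesis using True by (simp add: isCont_def log_norm_def)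
qed

text \<open>The function \<open>\<Delta>\<close> is nonincreasing: its derivative is nonpositive by
  the entropy inequality for \<open>t * h\<close>, which is
  \<open>\<bar>t\<bar> * L\<close>-Lipschitz.\<close>

lemma log_norm_le_bounded:
  assumes h: "L-lipschitz_on UNIV h" "bounded (range h)" and L: "L > 0"
    and q: "- (2 * sqrt lam / L) < q" and qp: "q \<le> p" and p: "p < 2 * sqrt lam / L"
  shows "log_norm M h p \<le> log_norm M h q + L\<^sup>2 * integral {q..p} (\<lambda>t. K_fun lam (\<bar>t\<bar> * L))"
proof -
  note hm = lipschitz_measurable[OF h(1)]
  define k where "k t = K_fun lam (\<bar>t\<bar> * L)" for t
  have k: "continuous_on {q..p} k"
    unfolding k_def by (rule K_fun_continuous_on[OF L q p])
  define \<Delta> where "\<Delta> t = log_norm M h t - L\<^sup>2 * integral {q..t} k" for t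
  have I: "((\<lambda>t. integral {q..t} k) has_real_derivative k t) (at t within {q..p})" if "t \<in> {q..p}" for t
    using integral_has_real_derivative[OF k that] .
  have cont: "continuous_on {q..p} \<Delta>"
    unfolding \<Delta>_def
  proof (intro continuous_intros)
    show "continuous_on {q..p} (log_norm M h)"
      using isCont_log_norm[OF hm h(2)] by (simp add: continuous_at_imp_continuous_on)
    show "continuous_on {q..p} (\<lambda>t. integral {q..t} k)"
      using I by (rule DERIV_continuous_on)
  qed
  have bound: "\<exists>y. (\<Delta> has_real_derivative y) (at t) \<and> y \<le> 0" if t: "q < t" "t < p" "t \<noteq> 0" for t
  proof -
    define F G where "F = (\<integral>x. exp (t * h x) \<partial>M)" and "G = (\<integral>x. h x * exp (t * h x) \<partial>M)"
    have F: "F > 0"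
      unfolding F_def by (intro integral_exp_pos integrable_comp[OF hm h(2)] continuous_intros)
    have "((\<lambda>t. integral {q..t} k) has_real_derivative k t) (at t)"
      using I[of t] t by (simp add: at_within_Icc_at)
    then have "(\<Delta> has_real_derivative (t * G / F - ln F) / t\<^sup>2 - L\<^sup>2 * k t) (at t)"
      unfolding \<Delta>_def F_def G_def
      by (intro derivative_intros log_norm_has_derivative[OF hm h(2) t(3)]) (auto intro!: derivative_eq_intros)
    moreover have "(t * G / F - ln F) / t\<^sup>2 \<le> L\<^sup>2 * k t"
    proof -
      have lip: "(\<bar>t\<bar> * L)-lipschitz_on UNIV (\<lambda>x. t * h x)"
        using lipschitz_on_cmult_real[OF h(1)] .
      have bdd: "bounded (range (\<lambda>x. t * h x))"
        using bounded_scaling[OF h(2), of t] by (simp add: image_image)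
      have "\<bar>t\<bar> < 2 * sqrt lam / L" using t q p by auto
      then have small: "\<bar>t\<bar> * L < 2 * sqrt lam" using L by (simp add: field_simps)
      have "t * G - F * ln F \<le> k t * (\<bar>t\<bar> * L)\<^sup>2 * F"
        using entropy_exp_le[OF lip bdd small] by (simp add: F_def G_def k_def mult.assoc)
      \<comment> \<open>Division by \<open>F * t^2\<close> leaves the derivative on the left, and
        \<open>L^2 * k t\<close> on the right.\<close>
      then have "(t * G - F * ln F) / (F * t\<^sup>2) \<le> k t * (\<bar>t\<bar> * L)\<^sup>2 * F / (F * t\<^sup>2)"
        using F by (intro divide_right_mono) auto
      then show ?thesis
        using F t by (simp add: power_mult_distrib diff_divide_distrib mult_ac)
    qed
    ultimately show ?thesis by fastforce
  qed
  have mono: "\<Delta> b \<le> \<Delta> a" if "q \<le> a" "a \<le> b" "b \<le> p" "0 \<notin> {a<..<b}" for a b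
  proof (rule DERIV_nonpos_imp_decreasing_open[OF that(2)])
    show "continuous_on {a..b} \<Delta>"
      by (rule continuous_on_subset[OF cont]) (use that in auto)
    show "\<exists>y. (\<Delta> has_real_derivative y) (at t) \<and> y \<le> 0" if "a < t" "t < b" for t
      using bound[of t] that \<open>q \<le> a\<close> \<open>b \<le> p\<close> \<open>0 \<notin> {a<..<b}\<close> by auto
  qed
  \<comment> \<open>The derivative bound is available only for nonzero \<open>t\<close>; an interval
    containing 0 inside is split there, and continuity of \<open>\<Delta>\<close> joins the two
    halves.\<close>
  have "\<Delta> p \<le> \<Delta> q"
  proof (cases "q < 0 \<and> 0 < p")
    case True
    then show ?thesis using mono[of q 0] mono[of 0 p] by simp
  next
    case False
    then show ?thesis using mono[of q p] qp by auto
  qed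
  then show ?thesis by (simp add: \<Delta>_def k_def[abs_def])
qed

section \<open>Passage to unbounded functions\<close>

text \<open>The truncations of \<open>\<bar>h\<bar>\<close> have variances bounded by
  \<open>S\<close> uniformly in \<open>n\<close>. On a fixed set of probability above 1/2 they are
  at most \<open>k\<close>, so their means cannot be far above \<open>k\<close> by a Chebyshev
  argument; Fatou's lemma concludes.\<close>

lemma lipschitz_integrable:
  fixes h :: "'a \<Rightarrow> real"
  assumes h: "L-lipschitz_on UNIV h"
  shows "integrable M h"
proof -
  note [measurable] = lipschitz_measurable[OF h]
  define g where "g n x = min (real n) \<bar>h x\<bar>" for n x
  have g0: "0 \<le> g n x" for n x by (simp add: g_def)
  have gL: "L-lipschitz_on UNIV (g n)" for n
  proof (rule lipschitz_onI)
    fix x y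
    have "dist (g n x) (g n y) \<le> dist (h x) (h y)"
      by (auto simp: g_def dist_real_def min_def)
    also have "\<dots> \<le> L * dist x y"
      using h by (rule lipschitz_onD) auto
    finally show "dist (g n x) (g n y) \<le> L * dist x y" .
  qed (rule lipschitz_on_nonneg[OF h])
  have gB: "bounded (range (g n))" for n
    unfolding bounded_iff by (rule exI[of _ "real n"]) (auto simp: g_def)
  note [measurable] = lipschitz_measurable[OF gL]
  note int = integrable_comp[OF lipschitz_measurable[OF gL] gB]
  have ig: "integrable M (g n)" for n using int[of "\<lambda>s. s" n] by simp
  define a where "a n = (\<integral>x. g n x \<partial>M)" for n
  define S where "S = L\<^sup>2 / lam"
  have S: "S \<ge> 0" using lam_pos by (simp add: S_def)
  have var: "(\<integral>x. (g n x - a n)\<^sup>2 \<partial>M) \<le> S" for n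
  proof -
    have "(\<integral>x. (g n x - a n)\<^sup>2 \<partial>M) = (\<integral>x. (g n x)\<^sup>2 \<partial>M) - (a n)\<^sup>2"
      unfolding a_def by (rule variance_eq[OF ig]) (intro int continuous_intros)
    moreover have "lam * ((\<integral>x. (g n x)\<^sup>2 \<partial>M) - (a n)\<^sup>2) \<le> L\<^sup>2"
      using poincare_comp[OF gL gB, of "\<lambda>s. s" "\<lambda>_. 1" n] by (simp add: prob_space a_def)
    ultimately show ?thesis using lam_pos by (simp add: S_def pos_le_divide_eq mult.commute)
  qed
  define A where "A k = {x \<in> space M. \<bar>h x\<bar> \<le> real k}" for k :: nat
  have [measurable]: "A k \<in> sets M" for k unfolding A_def by measurable
  have "(\<lambda>k. prob (A k)) \<longlonglongrightarrow> prob (\<Union>k. A k)"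
    by (rule finite_Lim_measure_incseq) (auto simp: incseq_def A_def)
  also have "(\<Union>k. A k) = space M"
    by (auto simp: A_def real_arch_simple)
  finally have "\<forall>\<^sub>F k in sequentially. 1 / 2 < prob (A k)"
    by (rule order_tendstoD) (simp add: prob_space)
  then obtain k where k: "1 / 2 < prob (A k)"
    by (auto simp: eventually_sequentially)
  have a_le: "a n \<le> real k + (2 * S + 1)" for n
  proof (rule ccontr)
    assume "\<not> ?thesis"
    then have far: "2 * S + 1 < a n - real k" by simp
    \<comment> \<open>Since \<open>2 * S + 1\<close> is at least 1, half of its square is at least
      \<open>S + 1 / 2\<close>, which exceeds the variance bound.\<close>
    have "(2 * S + 1) * 1 \<le> (2 * S + 1) * (2 * S + 1)"
      using S by (intro mult_left_mono) auto
    then have "(2 * S + 1) * (1 / 2) \<le> (2 * S + 1)\<^sup>2 * prob (A k)"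
      using k S unfolding power2_eq_square by (intro mult_mono) auto
    also have "\<dots> = (\<integral>x. (2 * S + 1)\<^sup>2 * indicator (A k) x \<partial>M)" by simp
    also have "\<dots> \<le> (\<integral>x. (g n x - a n)\<^sup>2 \<partial>M)"
    proof (intro integral_mono)
      show "integrable M (\<lambda>x. (2 * S + 1)\<^sup>2 * indicator (A k) x)"
        by (intro integrable_mult_right integrable_real_indicator) (auto simp: less_top[symmetric])
      show "integrable M (\<lambda>x. (g n x - a n)\<^sup>2)" by (intro int[of "\<lambda>s. (s - a n)\<^sup>2"] continuous_intros)
      show "(2 * S + 1)\<^sup>2 * indicator (A k) x \<le> (g n x - a n)\<^sup>2" for x
      proof (cases "x \<in> A k")
        case True
        then have "2 * S + 1 \<le> a n - g n x" using far by (auto simp: A_def g_def min_def)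
        then have "(2 * S + 1)\<^sup>2 \<le> (a n - g n x)\<^sup>2" using S by (intro power_mono) auto
        then show ?thesis using True by (simp add: power2_commute)
      qed simp
    qed
    finally show False using var[of n] S by simp
  qed
  have "integrable M (\<lambda>x. \<bar>h x\<bar>)"
  proof (rule integrable_of_bounded_approx[OF ig g0])
    show "(\<integral>x. g n x \<partial>M) \<le> real k + (2 * S + 1)" for n using a_le by (simp add: a_def)
    show "(\<lambda>n. g n x) \<longlonglongrightarrow> \<bar>h x\<bar>" for x
    proof (rule tendsto_eventually)
      obtain N where "\<bar>h x\<bar> \<le> real N" using real_arch_simple by blast
      then show "\<forall>\<^sub>F n in sequentially. g n x = \<bar>h x\<bar>"
        by (intro eventually_sequentiallyI[of N]) (auto simp: g_def)
    qed
  qed measurable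
  then show ?thesis by (simp add: integrable_abs_iff)
qed

text \<open>The bounded case with lower exponent 0 controls the truncations by their means, which
  are at most the integral of \<open>\<bar>h\<bar>\<close>. The resulting bound
  \<open>exp (t * J)\<close> does not depend on \<open>n\<close>.\<close>

lemma integrable_exp_lipschitz_pos:
  assumes h: "L-lipschitz_on UNIV h" and L: "L > 0" and t: "0 < t" "t < 2 * sqrt lam / L"
  shows "integrable M (\<lambda>x. exp (t * h x))"
proof -
  note [measurable] = lipschitz_measurable[OF h]
  have ih: "integrable M h" using h by (rule lipschitz_integrable)
  note cl = clamp_at_lipschitz[OF h]
  note int = integrable_comp[OF lipschitz_measurable[OF cl] bounded_clamp_at]
  define J where "J = (\<integral>x. \<bar>h x\<bar> \<partial>M) + L\<^sup>2 * integral {0..t} (\<lambda>t. K_fun lam (\<bar>t\<bar> * L))"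
  have i: "integrable M (\<lambda>x. exp (t * clamp_at n h x))" for n
    by (intro int[of "\<lambda>s. exp (t * s)"] continuous_intros)
  show ?thesis
  proof (rule integrable_of_bounded_approx[OF i])
    show "(\<integral>x. exp (t * clamp_at n h x) \<partial>M) \<le> exp (t * J)" for n
    proof -
      have "log_norm M (clamp_at n h) t \<le> log_norm M (clamp_at n h) 0
          + L\<^sup>2 * integral {0..t} (\<lambda>t. K_fun lam (\<bar>t\<bar> * L))"
        using t L lam_pos by (intro log_norm_le_bounded cl bounded_clamp_at) auto
      moreover have "log_norm M (clamp_at n h) 0 \<le> (\<integral>x. \<bar>h x\<bar> \<partial>M)"
        unfolding log_norm_def using ih int[of "\<lambda>s. s" n] abs_clamp_at_le[of n h]
        by (auto intro!: integral_mono simp: abs_le_iff)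
      ultimately have "log_norm M (clamp_at n h) t \<le> J" by (simp add: J_def)
      then have "ln (\<integral>x. exp (t * clamp_at n h x) \<partial>M) \<le> t * J"
        using t by (simp add: log_norm_def field_simps)
      then show ?thesis
        using integral_exp_pos[OF i, of n] by (metis exp_le_cancel_iff exp_ln)
    qed
    show "(\<lambda>n. exp (t * clamp_at n h x)) \<longlonglongrightarrow> exp (t * h x)" for x
      by (intro tendsto_intros clamp_at_tendsto)
  qed auto
qed

lemma integrable_exp_lipschitz:
  assumes h: "L-lipschitz_on UNIV h" and L: "L > 0" and t: "\<bar>t\<bar> < 2 * sqrt lam / L"
  shows "integrable M (\<lambda>x. exp (t * h x))"
proof -
  consider "t = 0" | "t > 0" | "t < 0" by linarith
  then show ?thesis
  proof cases
    case 2
    then show ?thesis using integrable_exp_lipschitz_pos[OF h L] t by simp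
  next
    case 3
    have "L-lipschitz_on UNIV (\<lambda>x. - h x)" using h by simp
    from integrable_exp_lipschitz_pos[OF this L, of "- t"] show ?thesis using 3 t by simp
  qed simp
qed

text \<open>Dominated convergence, with \<open>\<bar>h\<bar>\<close> for the means and
  \<open>exp (t * h) + exp (- t * h)\<close> for the exponentials. The latter is integrable because
  the range of exponents is symmetric.\<close>

lemma log_norm_clamp_tendsto:
  assumes h: "L-lipschitz_on UNIV h" and L: "L > 0" and t: "\<bar>t\<bar> < 2 * sqrt lam / L"
  shows "(\<lambda>n. log_norm M (clamp_at n h) t) \<longlonglongrightarrow> log_norm M h t"
proof -
  note [measurable] = lipschitz_measurable[OF h] lipschitz_measurable[OF clamp_at_lipschitz[OF h]]
  have ih: "integrable M h" using h by (rule lipschitz_integrable)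
  have ie: "integrable M (\<lambda>x. exp (t * h x) + exp (- t * h x))"
    using integrable_exp_lipschitz[OF h L, of t] integrable_exp_lipschitz[OF h L, of "- t"] t by simp
  have "(\<lambda>n. \<integral>x. clamp_at n h x \<partial>M) \<longlonglongrightarrow> (\<integral>x. h x \<partial>M)"
    by (rule integral_dominated_convergence[where w = "\<lambda>x. \<bar>h x\<bar>"])
      (use ih in \<open>auto intro: clamp_at_tendsto abs_clamp_at_le\<close>)
  moreover have "(\<lambda>n. \<integral>x. exp (t * clamp_at n h x) \<partial>M) \<longlonglongrightarrow> (\<integral>x. exp (t * h x) \<partial>M)"
  proof (rule integral_dominated_convergence[where w = "\<lambda>x. exp (t * h x) + exp (- t * h x)", OF _ _ ie])
    show "AE x in M. (\<lambda>n. exp (t * clamp_at n h x)) \<longlonglongrightarrow> exp (t * h x)"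
      by (intro AE_I2 tendsto_intros clamp_at_tendsto)
    show "AE x in M. norm (exp (t * clamp_at n h x)) \<le> exp (t * h x) + exp (- t * h x)" for n
    proof (rule AE_I2)
      fix x
      have "t * clamp_at n h x \<le> \<bar>t * h x\<bar>"
        using mult_left_mono[OF abs_clamp_at_le[of n h x], of "\<bar>t\<bar>"]
        by (simp flip: abs_mult)
      then have "exp (t * clamp_at n h x) \<le> exp \<bar>t * h x\<bar>" by simp
      also have "\<dots> \<le> exp (t * h x) + exp (- t * h x)"
        by (cases "t * h x \<ge> 0") auto
      finally show "norm (exp (t * clamp_at n h x)) \<le> exp (t * h x) + exp (- t * h x)" by simp
    qed
  qed measurable
  moreover have "(\<integral>x. exp (t * h x) \<partial>M) > 0"
    by (intro integral_exp_pos integrable_exp_lipschitz[OF h L t])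
  ultimately show ?thesis
    by (cases "t = 0") (simp_all add: log_norm_def tendsto_divide tendsto_ln)
qed

lemma log_norm_le:
  assumes h: "L-lipschitz_on UNIV h" and L: "L > 0"
    and q: "- (2 * sqrt lam / L) < q" and qp: "q < p" and p: "p < 2 * sqrt lam / L"
  shows "log_norm M h p \<le> log_norm M h q + L\<^sup>2 * integral {q..p} (\<lambda>t. K_fun lam (\<bar>t\<bar> * L))"
proof -
  define I where "I = L\<^sup>2 * integral {q..p} (\<lambda>t. K_fun lam (\<bar>t\<bar> * L))"
  have "(\<lambda>n. log_norm M (clamp_at n h) p) \<longlonglongrightarrow> log_norm M h p"
    using q qp p by (intro log_norm_clamp_tendsto[OF h L]) auto
  moreover have "(\<lambda>n. log_norm M (clamp_at n h) q + I) \<longlonglongrightarrow> log_norm M h q + I"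
    using q qp p by (intro tendsto_add log_norm_clamp_tendsto[OF h L] tendsto_const) auto
  moreover have "log_norm M (clamp_at n h) p \<le> log_norm M (clamp_at n h) q + I" for n
    unfolding I_def
    using log_norm_le_bounded[OF clamp_at_lipschitz[OF h] bounded_clamp_at L q _ p] qp by simp
  ultimately have "log_norm M h p \<le> log_norm M h q + I"
    by (intro LIMSEQ_le) auto
  then show ?thesis by (simp add: I_def)
qed

end

section \<open>Translation to norms with values in the extended reals\<close>

lemma ereal_exp_extended_integral:
  assumes "integrable M h"
  shows "ereal_exp (extended_integral M h) = ennreal (exp (\<integral>x. h x \<partial>M))"
proof -
  obtain a b where ab: "0 \<le> a" "0 \<le> b" "(\<integral>\<^sup>+x. ennreal (h x) \<partial>M) = ennreal a"
    "(\<integral>\<^sup>+x. ennreal (- h x) \<partial>M) = ennreal b" "(\<integral>x. h x \<partial>M) = a - b"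
    using assms by (rule integrableE)
  then show ?thesis
    using ab by (simp add: extended_integral_def ereal_exp_def enn2ereal_ennreal)
qed

text \<open>The integrals are finite, and that of the exponential is positive, so the infinite and
  zero branches of the extended power are avoided.\<close>

lemma (in prob_space) Lp_norm_eq_exp_log_norm:
  assumes pos: "\<And>x. 0 < f x" and int: "integrable M (\<lambda>x. ln (f x))"
    and exp: "integrable M (\<lambda>x. exp (t * ln (f x)))"
  shows "Lp_norm M t f = ennreal (exp (log_norm M (\<lambda>x. ln (f x)) t))"
proof (cases "t = 0")
  case True
  then show ?thesis by (simp add: Lp_norm_def log_norm_def ereal_exp_extended_integral[OF int])
next
  case False
  define F where "F = (\<integral>x. exp (t * ln (f x)) \<partial>M)"
  have "f x powr t = exp (t * ln (f x))" for x
    using pos[of x] by (simp add: powr_def)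
  then have "(\<integral>\<^sup>+x. ennreal (f x powr t) \<partial>M) = ennreal F"
    using exp by (simp add: F_def nn_integral_eq_integral)
  moreover have "F > 0" unfolding F_def by (rule integral_exp_pos[OF exp])
  ultimately show ?thesis
    using False by (simp add: Lp_norm_def ennreal_powr_def log_norm_def powr_def flip: F_def)
qed

theorem theorem1p1:
  fixes M :: "'a::polish_space measure"
    and lam L p q :: real
    and f :: "'a \<Rightarrow> real"
  assumes "prob_space M"
    and "sets M = sets borel"
    and "lam > 0"
    and "poincare_inequality lam M"
    and "L > 0"
    and "log_lipschitz L f"
    and "- (2 * sqrt lam / L) < q"
    and "q < p"
    and "p < 2 * sqrt lam / L"
  shows "Lp_norm M p f \<le> ennreal (C_const lam L q p) * Lp_norm M q f"
proof -
  interpret prob_space M by fact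
  interpret poincare_space M lam
    by unfold_locales fact+
  define h where "h x = ln (f x)" for x
  have f: "\<And>x. 0 < f x" and h: "L-lipschitz_on UNIV h"
    using assms(5,6) by (auto simp: log_lipschitz_def h_def dist_real_def intro!: lipschitz_onI)
  \<comment> \<open>Both \<open>p\<close> and \<open>q\<close> satisfy this bound on
    \<open>t\<close>, so the claim is the exponential of a real inequality.\<close>
  have norm: "Lp_norm M t f = ennreal (exp (log_norm M h t))" if "\<bar>t\<bar> < 2 * sqrt lam / L" for t
    using Lp_norm_eq_exp_log_norm[where t = t, OF f] lipschitz_integrable[OF h]
      integrable_exp_lipschitz[OF h \<open>L > 0\<close> that]
    by (simp add: h_def[abs_def])
  have "exp (log_norm M h p) \<le> C_const lam L q p * exp (log_norm M h q)"
    using log_norm_le[OF h assms(5,7-9)] by (simp add: C_const_def add.commute flip: exp_add)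
  then show ?thesis
    using norm[of p] norm[of q] assms(7-9)
    by (simp add: C_const_def ennreal_leI flip: ennreal_mult)
qed

end
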